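(* Let $q$ be a power of a prime $p$ and assume that $Q = (q^{\ell}-1)/(q-1)$ is prime for some prime $\ell$. Then the number of primitive elements $\xi \in \mathbb{F}_{q^{\ell}}$ satisfying $\operatorname{Tr}_{\mathbb{F}_{q^{\ell}}/\mathbb{F}_q}(\xi) = 0$ is $$\begin{cases} \phi(q^{\ell}-1)/q & \text{if } \ell \neq p;\\ \phi(q^{\ell}-1)/q - \phi(q-1) & \text{if } \ell = p.\end{cases}$$
   Context: $\phi$ is Euler's function. A primitive element of $\mathbb{F}_{q^\ell}$ is a generator of the multiplicative group $\mathbb{F}_{q^\ell}^*$. *)

theory Defs
  imports "HOL-Algebra.Algebra" "HOL-Number_Theory.Totient"
begin

definition primitive_element :: "('a, 'b) ring_scheme \<Rightarrow> 'a \<Rightarrow> bool" where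
  "primitive_element L \<xi> \<longleftrightarrow>
     \<xi> \<in> carrier (mult_of L) \<and> generate (mult_of L) {\<xi>} = carrier (mult_of L)"

text \<open>
  The trace of an extension \<open>L / K\<close> of finite fields: the sum of the conjugates
  \<open>x, x^q, \<dots>, x^(q^(n-1))\<close> of \<open>x\<close> over \<open>K\<close>, where \<open>q = card K\<close> and \<open>n = [L : K]\<close>
  (the powers of \<open>x \<mapsto> x^q\<close> are the elements of the Galois group of \<open>L / K\<close>).
\<close>

definition field_trace :: "('a, 'b) ring_scheme \<Rightarrow> 'a set \<Rightarrow> 'a \<Rightarrow> 'a" where
  "field_trace L K x =
     (\<Oplus>\<^bsub>L\<^esub> i \<in> {..<ring.dim L K (carrier L)}. x [^]\<^bsub>L\<^esub> (card K ^ i))"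

end

theory Submission
  imports Defs
begin

text \<open>
  Let \<open>L\<close> be a field with \<open>q ^ l\<close> elements and write
  \<open>q ^ l - 1 = Q * (q - 1)\<close> with \<open>Q\<close> prime. Since \<open>Q > q - 1\<close>, the two
  factors are coprime, and the cyclic group of nonzero elements of \<open>L\<close> is the direct product of
  its subgroups of orders \<open>Q\<close> and \<open>q - 1\<close>; the latter consists of the nonzero
  elements of \<open>K\<close>. Write an element as \<open>c u\<close> with \<open>c\<close> in \<open>K\<close> and
  \<open>u ^ Q = 1\<close>.

  \<^item> The trace is \<open>K\<close>-linear, so \<open>c u\<close> has trace zero exactly if \<open>u\<close> has.

  \<^item> Because \<open>Q\<close> is prime, \<open>c u\<close> is primitive exactly if \<open>c\<close> generates the
  nonzero elements of \<open>K\<close> and \<open>u \<noteq> 1\<close>.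

  Let \<open>z\<close> be the number of those \<open>u\<close> that have trace zero. Counting nonzero elements
  in the kernel of the trace gives \<open>q ^ (l - 1) - 1 = z * (q - 1)\<close>, and the number of primitive
  elements of trace zero is \<open>totient (q - 1)\<close> times \<open>z\<close>, where \<open>z\<close> has to be
  lowered by one if \<open>u = 1\<close> is among those counted. As \<open>1\<close> has trace \<open>l\<close>, this
  happens exactly if \<open>l = p\<close>. Finally \<open>Q - 1 = q * z\<close>, so
  \<open>totient (q ^ l - 1) = (Q - 1) * totient (q - 1) = q * z * totient (q - 1)\<close>.

  In the formal proof the direct product is replaced by the Chinese remainder theorem on exponents of
  a generator (\<open>card_chinese_remainder\<close>), and \<open>K\<close>-linearity by homogeneity under the
  solutions of \<open>c ^ q = c\<close> (\<open>conjugate_sum_smult\<close>). The size of the kernel of the trace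
  comes from bounding numbers of roots (\<open>card_conjugate_sum_kernel\<close>), which relies on
  additivity of the Frobenius map (\<open>frobenius_power_add\<close>). The dimension
  in the definition of the trace is \<open>l\<close>, as the cardinality of \<open>L\<close> shows
  (\<open>card_carrier_eq_power_dim\<close>).
\<close>

section \<open>Counting residues\<close>

lemma card_chinese_remainder:
  fixes a b :: nat
  assumes "coprime a b" "a > 0" "b > 0"
  shows "card {i. i < a * b \<and> P (i mod a) \<and> R (i mod b)} = card {r. r < a \<and> P r} * card {s. s < b \<and> R s}"
proof -
  have "bij_betw (\<lambda>i. (i mod a, i mod b)) {i. i < a * b \<and> P (i mod a) \<and> R (i mod b)}
          ({r. r < a \<and> P r} \<times> {s. s < b \<and> R s})"
  proof (rule bij_betwI')
    fix x y assume x: "x \<in> {i. i < a * b \<and> P (i mod a) \<and> R (i mod b)}"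
      and y: "y \<in> {i. i < a * b \<and> P (i mod a) \<and> R (i mod b)}"
    show "((x mod a, x mod b) = (y mod a, y mod b)) = (x = y)"
    proof
      assume "(x mod a, x mod b) = (y mod a, y mod b)"
      then have "[x = y] (mod (a * b))"
        using coprime_cong_mult_nat[of x y a b] assms(1) by (simp add: cong_def)
      then show "x = y" using x y by (auto simp: cong_def)
    qed simp
  next
    fix x assume "x \<in> {i. i < a * b \<and> P (i mod a) \<and> R (i mod b)}"
    then show "(x mod a, x mod b) \<in> {r. r < a \<and> P r} \<times> {s. s < b \<and> R s}"
      using assms by auto
  next
    fix y assume y: "y \<in> {r. r < a \<and> P r} \<times> {s. s < b \<and> R s}"
    then obtain r s where rs: "y = (r, s)" "r < a" "P r" "s < b" "R s" by auto
    obtain x where x: "x < a * b" "[x = r] (mod a)" "[x = s] (mod b)"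
      using binary_chinese_remainder_unique_nat[OF assms(1), of r s] assms by auto
    then show "\<exists>x\<in>{i. i < a * b \<and> P (i mod a) \<and> R (i mod b)}. y = (x mod a, x mod b)"
      using rs by (intro bexI[of _ x]) (auto simp: cong_def)
  qed
  then show ?thesis
    by (simp add: bij_betw_same_card card_cartesian_product)
qed

lemma totient_eq_card_residues:
  assumes "m > 0"
  shows "totient m = card {s. s < m \<and> coprime s m}"
proof (cases "m = 1")
  case True
  then have "{s. s < m \<and> coprime s m} = {0}" by auto
  then show ?thesis using True by simp
next
  case False
  then have "totatives m = {s. s < m \<and> coprime s m}"
    using assms by (auto simp: totatives_def le_less intro!: gr0I)
  then show ?thesis by (simp add: totient_def)
qed

section \<open>Cardinality and dimension\<close>

text \<open>
  Adjoining a vector \<open>v\<close> outside the subspace \<open>E'\<close> multiplies the cardinality by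
  that of \<open>K\<close>: from \<open>k \<otimes> v \<oplus> e = k' \<otimes> v \<oplus> e'\<close> with \<open>k \<noteq> k'\<close> one could divide by
  \<open>k \<ominus> k'\<close> and write \<open>v\<close> as an element of \<open>E'\<close>.
\<close>

lemma (in ring) card_of_dimension:
  assumes "subfield K R" "dimension n K E"
  shows "card E = card K ^ n"
  using assms(2)
proof (induction n arbitrary: E)
  case 0
  show ?case using dimension_zero[OF assms(1) 0] by simp
next
  case (Suc n)
  then obtain v E' where v: "v \<in> carrier R" "dimension n K E'" "v \<notin> E'" "E = line_extension K v E'"
    using dimension_backwards[OF assms(1)] by blast
  have sub: "subalgebra K E' R"
    using finite_dimension_imp_subalgebra[OF assms(1) finite_dimensionI[OF v(2)]] .
  then interpret V: subalgebra K E' R .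
  have subgroup: "subgroup E' (add_monoid R)" by unfold_locales
  have Kc: "K \<subseteq> carrier R" using subfieldE(3)[OF assms(1)] .
  have Ec: "E' \<subseteq> carrier R" using subalgebra_in_carrier[OF sub] .
  interpret K: subring K R using subfieldE(1)[OF assms(1)] .
  have inj: "inj_on (\<lambda>(k, e). k \<otimes> v \<oplus> e) (K \<times> E')"
  proof (rule inj_onI, clarsimp)
    fix k e k' e'
    assume A: "k \<in> K" "e \<in> E'" "k' \<in> K" "e' \<in> E'" and eq: "k \<otimes> v \<oplus> e = k' \<otimes> v \<oplus> e'"
    have c: "k \<in> carrier R" "k' \<in> carrier R" "e \<in> carrier R" "e' \<in> carrier R"
      using A Kc Ec by auto
    have *: "(k \<ominus> k') \<otimes> v = e' \<ominus> e"
    proof -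
      have "(k \<ominus> k') \<otimes> v = (k \<otimes> v \<oplus> e) \<ominus> k' \<otimes> v \<ominus> e"
        using c v(1) by algebra
      also have "\<dots> = e' \<ominus> e"
        unfolding eq using c v(1) by algebra
      finally show ?thesis .
    qed
    have "k = k'"
    proof (rule ccontr)
      assume "k \<noteq> k'"
      then have "k \<ominus> k' \<in> K - {\<zero>}"
        using A c subringE(5,7)[OF K.subring_axioms] r_right_minus_eq[of k k'] by (auto simp: a_minus_def)
      then have i: "inv (k \<ominus> k') \<in> K" "inv (k \<ominus> k') \<otimes> (k \<ominus> k') = \<one>"
        using subfield_m_inv[OF assms(1)] by auto
      have "e' \<ominus> e \<in> E'"
        unfolding a_minus_def using A(2,4) subgroup add.subgroupE(3,4) by blast
      then have "inv (k \<ominus> k') \<otimes> ((k \<ominus> k') \<otimes> v) \<in> E'"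
        unfolding * using V.smult_closed i(1) by blast
      moreover have "inv (k \<ominus> k') \<otimes> ((k \<ominus> k') \<otimes> v) = v"
        using i c v(1) Kc by (subst m_assoc[symmetric]) auto
      ultimately show False using v(3) by simp
    qed
    moreover then have "e = e'" using eq c v(1) by simp
    ultimately show "k = k' \<and> e = e'" by simp
  qed
  have "E = (\<lambda>(k, e). k \<otimes> v \<oplus> e) ` (K \<times> E')"
    unfolding v(4) using line_extension_mem_iff[of _ K v E'] by force
  then show ?case
    using inj Suc.IH[OF v(2)] by (simp add: card_image card_cartesian_product)
qed

lemma (in ring) card_carrier_eq_power_dim:
  assumes "subfield K R" "finite (carrier R)"
  shows "card (carrier R) = card K ^ dim K (carrier R)"
proof -
  obtain us where us: "set us = carrier R" using finite_list[OF assms(2)] by blast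
  have "Span K us = carrier R"
    using Span_base_incl[OF assms(1), of us] Span_in_carrier[of K us] subfieldE(3)[OF assms(1)] us by auto
  then have "finite_dimension K (carrier R)"
    using Span_finite_dimension[OF assms(1), of us] us by simp
  then obtain n where n: "dimension n K (carrier R)" by auto
  then have "dim K (carrier R) = n"
    using dimI[OF assms(1) n] by (simp add: over_def)
  then show ?thesis using card_of_dimension[OF assms(1) n] by simp
qed

section \<open>The characteristic and the Frobenius map\<close>

lemma (in cring) binomial_expansion:
  assumes x: "x \<in> carrier R" and y: "y \<in> carrier R"
  shows "(x \<oplus> y) [^] n = (\<Oplus>k\<in>{..n}. add_pow R (n choose k) (x [^] k \<otimes> y [^] (n - k)))"
proof (induction n)
  case 0
  show ?case by simp
next
  case (Suc n)
  define S where "S = (\<Oplus>k\<in>{..n}. add_pow R (n choose k) (x [^] k \<otimes> y [^] (n - k)))"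
  \<comment> \<open>After the term of index \<open>0\<close> is split off, Pascal's rule divides the expansion of the next power into \<open>A\<close> and \<open>B\<close>.\<close>
  define A where "A = (\<Oplus>k\<in>{..n}. add_pow R (n choose k) (x [^] Suc k \<otimes> y [^] (n - k)))"
  define B where "B = (\<Oplus>k\<in>{..n}. add_pow R (n choose Suc k) (x [^] Suc k \<otimes> y [^] (n - k)))"
  note c = x y nat_pow_closed m_closed add.nat_pow_closed
  have Sc: "S \<in> carrier R" unfolding S_def using c by (auto intro!: finsum_closed)
  have cl: "A \<in> carrier R" "B \<in> carrier R"
    unfolding A_def B_def using c by (auto intro!: finsum_closed)
  have mult: "add_pow R c (x [^] i \<otimes> y [^] j) \<otimes> x = add_pow R c (x [^] Suc i \<otimes> y [^] j)"
    "add_pow R c (x [^] i \<otimes> y [^] j) \<otimes> y = add_pow R c (x [^] i \<otimes> y [^] Suc j)" for c i j :: nat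
  proof -
    have z: "x [^] i \<otimes> y [^] j \<in> carrier R" using x y by simp
    have "x [^] i \<otimes> y [^] j \<otimes> x = x [^] Suc i \<otimes> y [^] j"
      "x [^] i \<otimes> y [^] j \<otimes> y = x [^] i \<otimes> y [^] Suc j"
      using x y by (simp_all add: m_ac)
    then show "add_pow R c (x [^] i \<otimes> y [^] j) \<otimes> x = add_pow R c (x [^] Suc i \<otimes> y [^] j)"
      "add_pow R c (x [^] i \<otimes> y [^] j) \<otimes> y = add_pow R c (x [^] i \<otimes> y [^] Suc j)"
      using add_pow_ldistr[OF z x] add_pow_ldistr[OF z y] by simp_all
  qed
  have "S \<otimes> x = (\<Oplus>k\<in>{..n}. add_pow R (n choose k) (x [^] k \<otimes> y [^] (n - k)) \<otimes> x)"
    unfolding S_def using c by (subst finsum_ldistr) auto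
  then have Sx: "S \<otimes> x = A"
    unfolding A_def mult .
  have "S \<otimes> y = (\<Oplus>k\<in>{..n}. add_pow R (n choose k) (x [^] k \<otimes> y [^] (n - k)) \<otimes> y)"
    unfolding S_def using c by (subst finsum_ldistr) auto
  also have "\<dots> = (\<Oplus>k\<in>{..n}. add_pow R (n choose k) (x [^] k \<otimes> y [^] (Suc n - k)))"
    unfolding mult using c by (intro finsum_cong') (auto simp: Suc_diff_le)
  also have "\<dots> = (\<Oplus>k\<in>{..Suc n}. add_pow R (n choose k) (x [^] k \<otimes> y [^] (Suc n - k)))"
    using c by (subst finsum_Suc) (auto simp: binomial_eq_0 intro!: finsum_closed)
  also have "\<dots> = B \<oplus> y [^] Suc n"
    unfolding B_def using c by (subst finsum_Suc2) auto
  finally have Sy: "S \<otimes> y = B \<oplus> y [^] Suc n" .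
  have "(\<Oplus>k\<in>{..Suc n}. add_pow R (Suc n choose k) (x [^] k \<otimes> y [^] (Suc n - k)))
     = (\<Oplus>k\<in>{..n}. add_pow R (n choose k) (x [^] Suc k \<otimes> y [^] (n - k))
              \<oplus> add_pow R (n choose Suc k) (x [^] Suc k \<otimes> y [^] (n - k))) \<oplus> y [^] Suc n"
    using c by (subst finsum_Suc2) (auto simp: add.nat_pow_mult)
  also have "\<dots> = (A \<oplus> B) \<oplus> y [^] Suc n"
    unfolding A_def B_def using c by (subst finsum_addf) auto
  also have "\<dots> = S \<otimes> x \<oplus> S \<otimes> y"
    unfolding Sx Sy using cl c by (simp add: a_ac)
  also have "\<dots> = (x \<oplus> y) [^] Suc n"
    using Suc c r_distr[OF x y Sc] by (simp add: S_def)
  finally show ?case by simp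
qed

lemma (in cring) add_pow_char_dvd:
  assumes "add_pow R p \<one> = \<zero>" "p dvd m" "z \<in> carrier R"
  shows "add_pow R (m::nat) z = \<zero>"
proof -
  obtain t where t: "m = p * t" using assms(2) by blast
  have "add_pow R p z = add_pow R p \<one> \<otimes> z" using assms(3) by (simp add: add_pow_ldistr)
  then have "add_pow R p z = \<zero>" using assms by simp
  then show ?thesis using assms(3) t by (metis add.nat_pow_one add.nat_pow_pow)
qed

text \<open>
  In the binomial expansion of a \<open>p\<close>-th power every coefficient except the first and
  the last is divisible by \<open>p\<close>, hence vanishes.
\<close>

lemma (in cring) frobenius_add:
  assumes "Factorial_Ring.prime (p::nat)" "add_pow R p \<one> = \<zero>"
    and x: "x \<in> carrier R" and y: "y \<in> carrier R"
  shows "(x \<oplus> y) [^] p = x [^] p \<oplus> y [^] p"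
proof -
  obtain m where m: "p = Suc (Suc m)"
    using prime_ge_2_nat[OF assms(1)] by (metis add_2_eq_Suc le_Suc_ex)
  have z: "add_pow R (p choose Suc i) (x [^] Suc i \<otimes> y [^] (p - Suc i)) = \<zero>" if "i \<le> m" for i
    using that m x y assms by (intro add_pow_char_dvd[OF assms(2)] dvd_choose_prime) auto
  have "(\<Oplus>i\<in>{..m}. add_pow R (p choose Suc i) (x [^] Suc i \<otimes> y [^] (p - Suc i))) = (\<Oplus>i\<in>{..m}. \<zero>)"
    by (rule finsum_cong') (simp_all only: z atMost_iff, simp)
  then have "(\<Oplus>i\<in>{..m}. add_pow R (p choose Suc i) (x [^] Suc i \<otimes> y [^] (p - Suc i))) = \<zero>"
    by simp
  then show ?thesis
    unfolding binomial_expansion[OF x y, of p] unfolding m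
    apply (subst finsum_Suc) using x y apply (auto)[1]
    apply (subst finsum_Suc2) using x y apply (auto)[1]
    using x y by auto
qed

lemma (in cring) frobenius_power_add:
  assumes "Factorial_Ring.prime (p::nat)" "add_pow R p \<one> = \<zero>"
    and x: "x \<in> carrier R" and y: "y \<in> carrier R"
  shows "(x \<oplus> y) [^] (p ^ k) = x [^] (p ^ k) \<oplus> y [^] (p ^ k)"
proof (induction k)
  case (Suc k)
  have "z [^] (p ^ Suc k) = (z [^] (p ^ k)) [^] p" if "z \<in> carrier R" for z
    using that by (simp add: nat_pow_pow mult.commute)
  then show ?case using Suc x y assms by (simp add: frobenius_add)
qed (use x y in simp)

text \<open>
  The characteristic is the only prime that annihilates \<open>\<one>\<close>: two distinct primes
  are coprime, and by Bezout they would together annihilate \<open>\<one>\<close> itself. This decides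
  whether \<open>\<one>\<close> has trace zero, which is where the cases \<open>l = p\<close> and
  \<open>l \<noteq> p\<close> part.
\<close>

lemma (in domain) add_pow_one_eq_zero_iff:
  assumes "Factorial_Ring.prime (p::nat)" "Factorial_Ring.prime (l::nat)" "add_pow R p \<one> = \<zero>"
  shows "add_pow R l \<one> = \<zero> \<longleftrightarrow> l = p"
proof
  assume l: "add_pow R l \<one> = \<zero>"
  show "l = p"
  proof (rule ccontr)
    assume "l \<noteq> p"
    then have "coprime p l" using assms primes_coprime by blast
    moreover have "p \<noteq> 0" using assms(1) by auto
    ultimately obtain a b where "p * a = l * b + 1"
      using bezout_nat[of p l] by auto
    then have "add_pow R (p * a) \<one> = add_pow R (l * b) \<one> \<oplus> \<one>"
      by (metis add.nat_pow_Suc add.nat_pow_0 Suc_eq_plus1 one_closed)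
    then have "\<one> = \<zero>"
      using add_pow_char_dvd[OF assms(3), of "p * a" \<one>] add_pow_char_dvd[OF l, of "l * b" \<one>] by simp
    then show False by simp
  qed
qed (use assms in simp)

lemma (in domain) pow_nonzero:
  assumes "x \<in> carrier R" "x \<noteq> \<zero>"
  shows "x [^] (n::nat) \<noteq> \<zero>"
  using assms by (induction n) (simp_all add: integral_iff)

text \<open>
  The additive group is annihilated by its order \<open>p ^ m\<close>, and in a domain a
  vanishing \<open>m\<close>-th power of \<open>p\<close> forces \<open>p\<close> to vanish.
\<close>

lemma (in field) char_of_prime_power_card:
  assumes "card (carrier R) = p ^ m"
  shows "add_pow R (p::nat) \<one> = \<zero>"
proof -
  have pw: "add_pow R (p ^ j) \<one> = add_pow R p \<one> [^] j" for j
  proof (induction j)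
    case (Suc j)
    have "add_pow R (p ^ Suc j) \<one> = add_pow R (p ^ j * p) \<one>" by (simp add: mult.commute)
    also have "\<dots> = add_pow R p (add_pow R (p ^ j) \<one> \<otimes> \<one>)"
      by (simp add: add.nat_pow_pow)
    also have "\<dots> = add_pow R (p ^ j) \<one> \<otimes> add_pow R p \<one>"
      by (subst add_pow_rdistr) auto
    finally show ?case using Suc by simp
  qed simp
  have "add_pow R (p ^ m) \<one> = \<zero>"
    using add.pow_order_eq_1[of \<one>] assms by (simp add: order_def)
  then have z: "add_pow R p \<one> [^] m = \<zero>" unfolding pw .
  then show ?thesis using pow_nonzero[of "add_pow R p \<one>" m] by auto
qed

section \<open>The trace as a sum of conjugates\<close>

text \<open>
  The trace of an extension of degree \<open>n\<close> over a field with \<open>q\<close> elements. With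
  \<open>n\<close> as an explicit parameter it allows induction on the number of summands.
\<close>

definition conjugate_sum :: "('a, 'b) ring_scheme \<Rightarrow> nat \<Rightarrow> nat \<Rightarrow> 'a \<Rightarrow> 'a" where
  "conjugate_sum R q n x = (\<Oplus>\<^bsub>R\<^esub>i\<in>{..<n}. x [^]\<^bsub>R\<^esub> (q ^ i))"

lemma (in cring) conjugate_sum_closed [simp]:
  "x \<in> carrier R \<Longrightarrow> conjugate_sum R q n x \<in> carrier R"
  unfolding conjugate_sum_def by (auto intro!: finsum_closed)

lemma (in cring) conjugate_sum_Suc:
  "x \<in> carrier R \<Longrightarrow> conjugate_sum R q (Suc n) x = x [^] (q ^ n) \<oplus> conjugate_sum R q n x"
  unfolding conjugate_sum_def by (auto simp: lessThan_Suc)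

text \<open>
  Scalars that are fixed by the Frobenius map can be pulled out of the trace. Fixed points are used in place
  of a subfield because membership is a plain power identity, easy to verify for powers of a
  generator.
\<close>

lemma (in cring) conjugate_sum_smult:
  assumes "c \<in> carrier R" "c [^] q = c" "x \<in> carrier R"
  shows "conjugate_sum R q n (c \<otimes> x) = c \<otimes> conjugate_sum R q n x"
proof -
  have c: "c [^] (q ^ i) = c" for i
  proof (induction i)
    case (Suc i)
    have "c [^] (q ^ Suc i) = (c [^] (q ^ i)) [^] q"
      using assms(1) by (simp add: nat_pow_pow mult.commute)
    then show ?case using Suc assms(2) by simp
  qed (use assms in simp)
  show ?thesis
    using assms(1,3) unfolding conjugate_sum_def
    by (subst finsum_rdistr) (auto simp: nat_pow_distrib c intro!: finsum_cong')
qed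

text \<open>
  Existence by induction, adding one monomial at a time: the new exponent
  \<open>q ^ Suc n\<close> exceeds the degree so far, so it becomes the new degree.
\<close>

lemma (in domain) conjugate_sum_polynomial:
  assumes "q \<ge> 2"
  shows "\<exists>f \<in> carrier (UP R). deg R f = q ^ n \<and>
           (\<forall>x\<in>carrier R. UnivPoly.eval R R id x f = conjugate_sum R q (Suc n) x)"
proof -
  interpret R: UP_domain R "UP R" by unfold_locales simp
  show ?thesis
  proof (induction n)
    case 0
    show ?case
      by (intro bexI[of _ "up_ring.monom (UP R) \<one> 1"]) (simp_all add: R.evalRR_simps conjugate_sum_def lessThan_Suc del: id_apply)
  next
    case (Suc n)
    then obtain f where f: "f \<in> carrier (UP R)" "deg R f = q ^ n"
      "\<And>x. x \<in> carrier R \<Longrightarrow> UnivPoly.eval R R id x f = conjugate_sum R q (Suc n) x"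
      by blast
    have lt: "q ^ n < q ^ Suc n" using assms by simp
    let ?g = "up_ring.monom (UP R) \<one> (q ^ Suc n) \<oplus>\<^bsub>UP R\<^esub> f"
    have "deg R ?g = q ^ Suc n"
      using f lt by (subst R.deg_add_eq) (auto simp del: power_Suc)
    moreover have "UnivPoly.eval R R id x ?g = conjugate_sum R q (Suc (Suc n)) x" if "x \<in> carrier R" for x
      using that f by (simp add: R.evalRR_simps conjugate_sum_Suc del: power_Suc)
    ultimately show ?case
      using f(1) by (intro bexI[of _ ?g] conjI ballI) (simp_all del: power_Suc id_apply)
  qed
qed

lemma (in domain) card_conjugate_sum_fibre_le:
  assumes fin: "finite (carrier R)" and "q \<ge> 2" and a: "a \<in> carrier R"
  shows "card {x \<in> carrier R. conjugate_sum R q (Suc n) x = a} \<le> q ^ n"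
proof -
  interpret R: UP_domain R "UP R" by unfold_locales simp
  obtain f where f: "f \<in> carrier (UP R)" "deg R f = q ^ n"
      "\<And>x. x \<in> carrier R \<Longrightarrow> UnivPoly.eval R R id x f = conjugate_sum R q (Suc n) x"
    using conjugate_sum_polynomial[OF assms(2)] by blast
  let ?g = "f \<ominus>\<^bsub>UP R\<^esub> up_ring.monom (UP R) a 0"
  have gc: "?g \<in> carrier (UP R)" using f a by simp
  have dg: "deg R ?g = q ^ n"
    using f a assms(2) by (subst R.deg_minus_eq) auto
  then have "?g \<noteq> \<zero>\<^bsub>UP R\<^esub>"
    using assms(2) by (intro R.deg_nzero_nzero) auto
  then have "card {x \<in> carrier R. UnivPoly.eval R R id x ?g = \<zero>} \<le> q ^ n"
    using R.roots_bound[OF gc _ fin] dg by simp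
  moreover have "{x \<in> carrier R. UnivPoly.eval R R id x ?g = \<zero>} = {x \<in> carrier R. conjugate_sum R q (Suc n) x = a}"
    using f a by (auto simp: R.evalRR_simps)
  ultimately show ?thesis by simp
qed

lemma (in domain) card_fixed_powers_le:
  assumes fin: "finite (carrier R)" and "q \<ge> 2"
  shows "card {x \<in> carrier R. x [^] q = x} \<le> q"
proof -
  interpret R: UP_domain R "UP R" by unfold_locales simp
  let ?g = "up_ring.monom (UP R) \<one> q \<ominus>\<^bsub>UP R\<^esub> up_ring.monom (UP R) \<one> 1"
  have gc: "?g \<in> carrier (UP R)" by simp
  have dg: "deg R ?g = q"
    using assms(2) by (subst R.deg_minus_eq) auto
  then have "?g \<noteq> \<zero>\<^bsub>UP R\<^esub>"
    using assms(2) by (intro R.deg_nzero_nzero) auto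
  then have "card {x \<in> carrier R. UnivPoly.eval R R id x ?g = \<zero>} \<le> q"
    using R.roots_bound[OF gc _ fin] dg by simp
  moreover have "{x \<in> carrier R. UnivPoly.eval R R id x ?g = \<zero>} = {x \<in> carrier R. x [^] q = x}"
    by (auto simp: R.evalRR_simps)
  ultimately show ?thesis by simp
qed

lemma (in field) pow_card_carrier:
  assumes "finite (carrier R)" "x \<in> carrier R"
  shows "x [^] card (carrier R) = x"
proof (cases "x = \<zero>")
  case True
  moreover have "card (carrier R) > 0" using assms by (auto simp: card_gt_0_iff)
  ultimately show ?thesis by (simp add: nat_pow_zero)
next
  case False
  interpret G: group "Multiplicative_Group.mult_of R" by (rule field_mult_group)
  have "card (carrier R) > 0" using assms by (auto simp: card_gt_0_iff)
  then have "card (carrier R) = Suc (order (Multiplicative_Group.mult_of R))"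
    using order_mult_of[OF assms(1)] by (simp add: order_def)
  moreover have "x [^] order (Multiplicative_Group.mult_of R) = \<one>"
    using G.pow_order_eq_1[of x] False assms(2) by (simp add: Multiplicative_Group.nat_pow_mult_of)
  ultimately show ?thesis using assms(2) by simp
qed

text \<open>
  Raising to the power \<open>q\<close> is additive, so it permutes the conjugates cyclically:
  the last one becomes \<open>x [^] (q ^ n) = x\<close>.
\<close>

lemma (in field) conjugate_sum_fixed:
  assumes p: "Factorial_Ring.prime (p::nat)" "q = p ^ k"
    and card: "card (carrier R) = q ^ n" and x: "x \<in> carrier R"
  shows "conjugate_sum R q n x [^] q = conjugate_sum R q n x"
proof (cases n)
  case 0
  then show ?thesis using p
    by (simp add: conjugate_sum_def nat_pow_zero prime_gt_0_nat)
next
  case (Suc m)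
  have fin: "finite (carrier R)"
    using card p by (metis card.infinite power_not_zero not_prime_0)
  have ch: "add_pow R p \<one> = \<zero>"
    using char_of_prime_power_card card p by (metis power_mult)
  have add: "(u \<oplus> v) [^] q = u [^] q \<oplus> v [^] q" if "u \<in> carrier R" "v \<in> carrier R" for u v
    unfolding p using frobenius_power_add[OF p(1) ch that] .
  have shift: "conjugate_sum R q j x [^] q = (\<Oplus>i\<in>{..<j}. x [^] (q ^ Suc i))" for j
  proof (induction j)
    case 0 then show ?case using p
      by (simp add: conjugate_sum_def nat_pow_zero prime_gt_0_nat)
  next
    case (Suc j)
    then show ?case using x
      by (simp add: conjugate_sum_Suc add lessThan_Suc nat_pow_pow mult.commute)
  qed
  have "conjugate_sum R q n x [^] q = (\<Oplus>i\<in>{..m}. x [^] (q ^ Suc i))"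
    unfolding shift unfolding Suc by (simp add: lessThan_Suc_atMost)
  also have "\<dots> = x [^] (q ^ n) \<oplus> (\<Oplus>i\<in>{..<m}. x [^] (q ^ Suc i))"
    using x unfolding Suc by (simp add: lessThan_Suc_atMost[symmetric] lessThan_Suc)
  also have "x [^] (q ^ n) = x [^] (q ^ 0)"
    using pow_card_carrier[OF fin x] card x by simp
  also have "x [^] (q ^ 0) \<oplus> (\<Oplus>i\<in>{..<m}. x [^] (q ^ Suc i)) = conjugate_sum R q n x"
  proof -
    have "(\<Oplus>i\<in>{..m}. x [^] (q ^ i)) = (\<Oplus>i\<in>{..<m}. x [^] (q ^ Suc i)) \<oplus> x [^] (q ^ 0)"
    proof (cases m)
      case (Suc j)
      then show ?thesis
        using finsum_Suc2[of "\<lambda>i. x [^] (q ^ i)" j] x by (simp add: lessThan_Suc_atMost)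
    qed (use x in simp)
    then show ?thesis
      using x unfolding conjugate_sum_def Suc lessThan_Suc_atMost by (simp add: a_comm)
  qed
  finally show ?thesis .
qed

text \<open>
  The values of the trace satisfy \<open>y [^] q = y\<close>, so there are at most \<open>q\<close> of
  them, and each fibre has at most \<open>q ^ n\<close> elements because it is the root set of a
  polynomial of that degree. As the fibres cover \<open>q ^ Suc n\<close> elements, both bounds
  are attained; in particular by the fibre over \<open>\<zero>\<close>.
\<close>

lemma (in field) card_conjugate_sum_kernel:
  assumes p: "Factorial_Ring.prime (p::nat)" "q = p ^ k" "k \<ge> 1"
    and card: "card (carrier R) = q ^ Suc n"
  shows "card {x \<in> carrier R. conjugate_sum R q (Suc n) x = \<zero>} = q ^ n"
proof -
  have q: "q \<ge> 2" using prime_ge_2_nat[OF p(1)] self_le_power[of p k] p by simp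
  have fin: "finite (carrier R)"
    using card q by (intro card_ge_0_finite) (simp del: power_Suc)
  define F where "F a = {x \<in> carrier R. conjugate_sum R q (Suc n) x = a}" for a
  define V where "V = {y \<in> carrier R. y [^] q = y}"
  have finV: "finite V" and "\<zero> \<in> V" unfolding V_def using fin q by (auto simp: nat_pow_zero)
  have cV: "card (V - {\<zero>}) \<le> q - 1"
    using card_fixed_powers_le[OF fin q] finV \<open>\<zero> \<in> V\<close> by (simp add: V_def[symmetric])
  have F: "card (F a) \<le> q ^ n" if "a \<in> carrier R" for a
    unfolding F_def using card_conjugate_sum_fibre_le[OF fin q that] .
  have "carrier R = (\<Union>a\<in>V. F a)"
    unfolding F_def V_def using conjugate_sum_fixed[OF p(1,2) card] by auto
  then have "q ^ Suc n \<le> (\<Sum>a\<in>V. card (F a))"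
    using card_UN_le[OF finV, of F] card by simp
  also have "\<dots> = card (F \<zero>) + (\<Sum>a\<in>V-{\<zero>}. card (F a))"
    using finV \<open>\<zero> \<in> V\<close> by (simp add: sum.remove)
  also have "(\<Sum>a\<in>V-{\<zero>}. card (F a)) \<le> (\<Sum>a\<in>V-{\<zero>}. q ^ n)"
    by (intro sum_mono F) (auto simp: V_def)
  also have "\<dots> \<le> (q - 1) * q ^ n"
    using cV by simp
  finally have "q * q ^ n \<le> card (F \<zero>) + (q - 1) * q ^ n" by simp
  moreover have "q * q ^ n = q ^ n + (q - 1) * q ^ n"
    using q by (simp add: mult_eq_if)
  ultimately have "q ^ n \<le> card (F \<zero>)" by simp
  then show ?thesis using F[of \<zero>] by (simp add: F_def)
qed

section \<open>Primitive elements of trace zero\<close>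

text \<open>
  Of these two copies of the multiplicative group, \<open>primitive_element\<close> refers to the
  first, the results on cyclicity and element orders to the second.
\<close>

lemma mult_of_eq: "Ring_Divisibility.mult_of R = Multiplicative_Group.mult_of R"
  by (simp add: Ring_Divisibility.mult_of_def Multiplicative_Group.mult_of_def)

text \<open>
  Passing to exponents of a generator turns questions about field elements into
  questions about residues modulo \<open>card (carrier R) - 1\<close>.
\<close>

lemma (in field) cyclic_generator:
  assumes "finite (carrier R)"
  obtains g where "g \<in> carrier R" "g \<noteq> \<zero>"
    "bij_betw (\<lambda>i. g [^] i) {i. i < card (carrier R) - 1} (carrier R - {\<zero>})"
    "g [^] (card (carrier R) - 1) = \<one>"
    "\<And>i. primitive_element R (g [^] i) \<longleftrightarrow> coprime i (card (carrier R) - 1)"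
proof -
  let ?G = "Multiplicative_Group.mult_of R"
  note [simp] = Multiplicative_Group.nat_pow_mult_of
  interpret G: group ?G by (rule field_mult_group)
  obtain g where g: "g \<in> carrier ?G" "carrier ?G = {g [^] i | i::nat. i \<in> UNIV}"
    using finite_field_mult_group_has_gen[OF assms] by blast
  have fin: "finite (carrier ?G)" using assms by simp
  have n: "order ?G = card (carrier R) - 1"
    using order_mult_of[OF assms] by (simp add: order_def)
  have ord0: "G.ord g \<noteq> 0" using G.ord_ge_1[OF fin g(1)] by simp
  have "generate ?G {g} = carrier ?G"
    using G.generate_pow_nat[OF g(1) ord0] g(2) by simp
  then have ord: "G.ord g = card (carrier R) - 1"
    using G.generate_pow_card[OF g(1)] n by (simp add: order_def)
  have prim: "primitive_element R x \<longleftrightarrow> G.ord x = card (carrier R) - 1" if "x \<in> carrier ?G" for x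
  proof -
    have "generate ?G {x} \<subseteq> carrier ?G" using G.generate_incl that by simp
    then have "generate ?G {x} = carrier ?G \<longleftrightarrow> card (generate ?G {x}) = card (carrier ?G)"
      using fin card_subset_eq by metis
    then show ?thesis
      using G.generate_pow_card[OF that] n that
      by (simp add: primitive_element_def mult_of_eq order_def)
  qed
  have im: "(\<lambda>i. g [^] i) ` {i. i < card (carrier R) - 1} = carrier R - {\<zero>}"
  proof -
    have "{i. i < card (carrier R) - 1} = {0..G.ord g - 1}" using ord ord0 by auto
    then have "(\<lambda>i. g [^] i) ` {i. i < card (carrier R) - 1} = {g [^] i | i::nat. i \<in> UNIV}"
      using G.ord_elems[OF fin g(1)] by (auto simp del: One_nat_def)
    then show ?thesis using g(2) by simp
  qed
  have "bij_betw (\<lambda>i. g [^] i) {i. i < card (carrier R) - 1} (carrier R - {\<zero>})"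
  proof (rule bij_betw_imageI[OF eq_card_imp_inj_on im])
    show "card ((\<lambda>i. g [^] i) ` {i. i < card (carrier R) - 1}) = card {i. i < card (carrier R) - 1}"
      unfolding im using assms by simp
  qed simp
  moreover have "g [^] (card (carrier R) - 1) = \<one>"
    using G.pow_order_eq_1[OF g(1)] n by simp
  moreover have "primitive_element R (g [^] i) \<longleftrightarrow> coprime i (card (carrier R) - 1)" for i :: nat
    using prim[of "g [^] i"] G.pow_ord_eq_ord_iff[OF fin g(1), of i] G.nat_pow_closed[OF g(1), of i] ord
    by simp
  ultimately show ?thesis using that[of g] g(1) by simp
qed

text \<open>
  The count. The exponents \<open>i\<close> of a generator \<open>g\<close> are split by
  the Chinese remainder theorem into \<open>(i mod Q, i mod (q - 1))\<close>. Trace zero depends on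
  the first coordinate only; let \<open>z\<close> be the number of residues modulo \<open>Q\<close> that
  give trace zero. As \<open>Q\<close> is prime, being primitive means that the first coordinate is nonzero and
  the second is coprime to \<open>q - 1\<close>. Hence \<open>z * (q - 1)\<close> counts the nonzero elements of trace
  zero, which determines \<open>z\<close>, and the wanted number is \<open>totient (q - 1)\<close> times
  \<open>z\<close>, or times \<open>z - 1\<close> if the residue \<open>0\<close> is among the \<open>z\<close>.
\<close>

lemma (in field) card_primitive_conjugate_sum_kernel:
  fixes p k q l Q :: nat
  assumes p: "Factorial_Ring.prime p" "q = p ^ k" "k \<ge> 1"
    and l: "Factorial_Ring.prime l" and Q: "Factorial_Ring.prime Q" "q ^ l - 1 = Q * (q - 1)"
    and card: "card (carrier R) = q ^ l"
  shows "real (card {x \<in> carrier R. primitive_element R x \<and> conjugate_sum R q l x = \<zero>}) =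
    real (totient (q ^ l - 1)) / real q - (if l = p then real (totient (q - 1)) else 0)"
proof -
  have q: "q \<ge> 2" using prime_ge_2_nat[OF p(1)] self_le_power[of p k] p by simp
  obtain m where m: "l = Suc m"
    using prime_ge_2_nat[OF l] by (cases l) auto
  have fin: "finite (carrier R)"
    using card q by (intro card_ge_0_finite) simp
  \<comment> \<open>The prime \<open>Q\<close> is too large to divide \<open>q - 1\<close>; this is where \<open>l \<ge> 2\<close> enters.\<close>
  have Qgt: "Q > q - 1"
  proof -
    have "q * q \<le> q ^ l"
      using q prime_ge_2_nat[OF l] power_increasing[of 2 l q] by (simp add: power2_eq_square)
    then have "(q - 1) * (q - 1) < q ^ l - 1"
      using q by (cases q) auto
    then show ?thesis unfolding Q(2) by simp
  qed
  then have cop: "coprime Q (q - 1)"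
    using q by (intro prime_imp_coprime[OF Q(1)]) (auto dest!: dvd_imp_le)
  obtain g where g: "g \<in> carrier R" "g \<noteq> \<zero>"
    "bij_betw (\<lambda>i. g [^] i) {i. i < q ^ l - 1} (carrier R - {\<zero>})"
    "g [^] (q ^ l - 1) = \<one>"
    "\<And>i. primitive_element R (g [^] i) \<longleftrightarrow> coprime i (q ^ l - 1)"
    using cyclic_generator[OF fin] unfolding card by metis
  define Z where "Z r \<longleftrightarrow> conjugate_sum R q l (g [^] r) = \<zero>" for r :: nat
  \<comment> \<open>The powers of \<open>g [^] Q\<close> are the nonzero fixed points of the Frobenius map, so the trace commutes with multiplication by them.\<close>
  have Zmod: "Z i \<longleftrightarrow> Z (i mod Q)" for i
  proof -
    define c where "c = g [^] (Q * (i div Q))"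
    have c: "c \<in> carrier R" "c \<noteq> \<zero>" unfolding c_def using g(1,2) by (auto simp: pow_nonzero)
    have "c [^] q = c [^] (q - 1) \<otimes> c"
      using q c nat_pow_Suc[of c "q - 1"] by simp
    also have "c [^] (q - 1) = (g [^] (q ^ l - 1)) [^] (i div Q)"
      unfolding c_def Q(2) using g(1) by (simp add: nat_pow_pow mult_ac)
    finally have "c [^] q = c" using c g(4) by simp
    moreover have "g [^] i = c \<otimes> g [^] (i mod Q)"
      unfolding c_def using g(1) by (simp add: nat_pow_mult)
    ultimately show ?thesis
      unfolding Z_def using c g(1) by (simp add: conjugate_sum_smult integral_iff)
  qed
  have count: "card {x \<in> carrier R - {\<zero>}. P x} = card {i. i < q ^ l - 1 \<and> P (g [^] i)}" for P
  proof -
    have "bij_betw (\<lambda>i. g [^] i) {i. i < q ^ l - 1 \<and> P (g [^] i)} {x \<in> carrier R - {\<zero>}. P x}"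
      using g(3) unfolding bij_betw_def by (auto simp: inj_on_def)
    then show ?thesis by (rule bij_betw_same_card[symmetric])
  qed
  define z where "z = card {r. r < Q \<and> Z r}"
  have Qpos: "Q > 0" "q - 1 > 0" using prime_gt_0_nat[OF Q(1)] q by auto
  have z: "q ^ m - 1 = z * (q - 1)"
  proof -
    have "{x \<in> carrier R - {\<zero>}. conjugate_sum R q l x = \<zero>} = {x \<in> carrier R. conjugate_sum R q l x = \<zero>} - {\<zero>}"
      by auto
    moreover have "conjugate_sum R q l \<zero> = \<zero>"
      using conjugate_sum_smult[of \<zero> q \<zero> l] q by (simp add: nat_pow_zero)
    ultimately have "card {x \<in> carrier R - {\<zero>}. conjugate_sum R q l x = \<zero>} = q ^ m - 1"
      using card_conjugate_sum_kernel[OF p card[unfolded m]] fin m by simp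
    moreover have "{i. i < q ^ l - 1 \<and> conjugate_sum R q l (g [^] i) = \<zero>} = {i. i < Q * (q - 1) \<and> Z (i mod Q) \<and> True}"
      using Zmod unfolding Z_def Q(2) by auto
    ultimately show ?thesis
      using count[of "\<lambda>x. conjugate_sum R q l x = \<zero>"] card_chinese_remainder[OF cop Qpos, of Z "\<lambda>_. True"]
      by (simp add: z_def)
  qed
  \<comment> \<open>The factor \<open>q\<close> here is the divisor of the totient in the claim.\<close>
  have "(Q - 1) * (q - 1) = q ^ l - 1 - (q - 1)"
    unfolding Q(2) by (simp add: diff_mult_distrib)
  also have "\<dots> = q * (q ^ m - 1)"
    unfolding m using q by (simp add: diff_mult_distrib2)
  also have "\<dots> = q * z * (q - 1)" unfolding z by simp
  finally have Qz: "Q - 1 = q * z" using q by simp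
  have tot: "totient (q ^ l - 1) = q * z * totient (q - 1)"
    unfolding Q(2) totient_mult_coprime[OF cop] using totient_prime[OF Q(1)] Qz by simp
  have "add_pow R p \<one> = \<zero>"
    using char_of_prime_power_card[of p "k * l"] card p(2) by (simp add: power_mult)
  then have "add_pow R l \<one> = \<zero> \<longleftrightarrow> l = p"
    using add_pow_one_eq_zero_iff[OF p(1) l] by simp
  moreover have "conjugate_sum R q l \<one> = add_pow R l \<one>"
    using add.finprod_const[of \<one> "{..<l}"] by (simp add: conjugate_sum_def)
  ultimately have Z0: "Z 0 \<longleftrightarrow> l = p" unfolding Z_def by simp
  have "{r. r < Q \<and> r \<noteq> 0 \<and> Z r} = (if l = p then {r. r < Q \<and> Z r} - {0} else {r. r < Q \<and> Z r})"
    using Z0 by (auto intro!: gr0I)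
  moreover have "0 \<in> {r. r < Q \<and> Z r} \<longleftrightarrow> l = p" using Z0 Qpos by simp
  ultimately have Znz: "card {r. r < Q \<and> r \<noteq> 0 \<and> Z r} = (if l = p then z - 1 else z)"
    by (simp add: z_def)
  \<comment> \<open>Needed since \<open>z - 1\<close> is a truncated difference of natural numbers.\<close>
  have zpos: "z \<ge> 1" if "l = p"
    using Z0 Qpos that by (auto simp: z_def Suc_le_eq card_gt_0_iff)
  have "{x \<in> carrier R. primitive_element R x \<and> conjugate_sum R q l x = \<zero>} =
     {x \<in> carrier R - {\<zero>}. primitive_element R x \<and> conjugate_sum R q l x = \<zero>}"
    by (auto simp: primitive_element_def)
  then have "card {x \<in> carrier R. primitive_element R x \<and> conjugate_sum R q l x = \<zero>}
     = card {i. i < q ^ l - 1 \<and> coprime i (q ^ l - 1) \<and> Z i}"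
    using count[of "\<lambda>x. primitive_element R x \<and> conjugate_sum R q l x = \<zero>"] g(5)
    by (simp add: Z_def)
  also have "{i. i < q ^ l - 1 \<and> coprime i (q ^ l - 1) \<and> Z i}
     = {i. i < Q * (q - 1) \<and> (i mod Q \<noteq> 0 \<and> Z (i mod Q)) \<and> coprime (i mod (q - 1)) (q - 1)}"
  proof -
    have "coprime i Q \<longleftrightarrow> i mod Q \<noteq> 0" for i
      using Q(1) prime_imp_coprime[OF Q(1), of i]
      by (auto simp: coprime_commute mod_eq_0_iff_dvd dest: coprime_common_divisor not_prime_unit)
    then show ?thesis
      unfolding Q(2) using Zmod Qpos by (auto simp: coprime_mult_right_iff)
  qed
  also have "card \<dots> = card {r. r < Q \<and> r \<noteq> 0 \<and> Z r} * totient (q - 1)"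
    unfolding totient_eq_card_residues[OF Qpos(2)]
    using card_chinese_remainder[OF cop Qpos, of "\<lambda>r. r \<noteq> 0 \<and> Z r" "\<lambda>s. coprime s (q - 1)"] by simp
  finally show ?thesis
    unfolding Znz tot using q zpos by (auto simp: of_nat_diff algebra_simps)
qed

theorem corollary1p5:
  fixes L :: "('a, 'b) ring_scheme" and K :: "'a set" and p k q l :: nat
  assumes "Factorial_Ring.prime p" and "k \<ge> 1" and "q = p ^ k"
    and "Factorial_Ring.prime l"
    and "Factorial_Ring.prime ((q ^ l - 1) div (q - 1))"
    and "field L" and "card (carrier L) = q ^ l"
    and "subfield K L" and "card K = q"
  shows "real (card {\<xi> \<in> carrier L. primitive_element L \<xi> \<and> field_trace L K \<xi> = \<zero>\<^bsub>L\<^esub>}) =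
    (if l \<noteq> p then real (totient (q ^ l - 1)) / real q
     else real (totient (q ^ l - 1)) / real q - real (totient (q - 1)))"
proof -
  interpret L: field L by fact
  have q: "q \<ge> 2" using prime_ge_2_nat[OF assms(1)] self_le_power[of p k] assms(1-3) by simp
  have "finite (carrier L)"
    using assms(7) q by (intro card_ge_0_finite) simp
  then have "q ^ l = q ^ L.dim K (carrier L)"
    using L.card_carrier_eq_power_dim[OF assms(8)] assms(7,9) by simp
  then have "L.dim K (carrier L) = l"
    using q power_inject_exp[of q l "L.dim K (carrier L)"] by simp
  then have trace: "field_trace L K x = conjugate_sum L q l x" for x
    by (simp add: field_trace_def conjugate_sum_def assms(9))
  have "q - 1 dvd q ^ l - 1"
  proof -
    have "[q ^ l = 1 ^ l] (mod (q - 1))"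
      using q by (intro cong_pow) (simp add: cong_altdef_nat)
    then show ?thesis using q by (simp add: cong_altdef_nat)
  qed
  then have "q ^ l - 1 = (q ^ l - 1) div (q - 1) * (q - 1)" by simp
  from L.card_primitive_conjugate_sum_kernel[OF assms(1,3,2,4,5) this assms(7)]
  show ?thesis unfolding trace by simp
qed

end
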